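(* Let $\Pi$ be an equivalence relation on $\mathbb{N}$ decided by a total recursive $\pi$. Then $\Pi$ is permutable if and only if the predicate $\rho(x) = [\exists x' > x : x' \Pi x]$ is recursive. Moreover, given $\pi$, such a $\rho$ can be computed from the normal permutation associated to $\Pi$ (and hence, in the presence of $\pi$, from any recursive permutation whose cycles are the blocks of $\Pi$), and conversely a recursive permutation whose cycles are the blocks of $\Pi$ can be computed from $\pi$ and $\rho$.
   Context: An equivalence $\Pi$ is permutable if there is a recursive permutation $f$ of $\mathbb{N}$ whose cycles $\{f^k(x):k\in\mathbb{Z}\}$ are exactly the blocks of $\Pi$. $[p]$ is the truth value of predicate $p$. Let $\delta:\mathbb{Z}\to\mathbb{N}$, $\delta(0)=0$, $\delta(k)=2k$ ($k>0$), $\delta(k)=-2k-1$ ($k<0$). A permutation $g$ is normal if for each cycle, with least element $a_0$ and length $n\in\mathbb{N}^+\cup\{\infty\}$, $j\mapsto g^{\delta^{-1}(j)}(a_0)$ is strictly increasing for $0\le j<n$; if $\Pi$ is decidable and permutable, there is exactly one recursive normal permutation whose cycles are the blocks of $\Pi$. *)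

theory Defs
  imports Main
begin

text \<open>Partial functions of any arity, on argument lists; arguments of the wrong length are mapped
  to \<^term>\<open>None\<close>.\<close>

type_synonym pfun = "nat list \<Rightarrow> nat option"

definition unary :: "(nat \<Rightarrow> nat) \<Rightarrow> pfun" where
  "unary f xs = (case xs of [x] \<Rightarrow> Some (f x) | _ \<Rightarrow> None)"

definition binary :: "(nat \<Rightarrow> nat \<Rightarrow> nat) \<Rightarrow> pfun" where
  "binary f xs = (case xs of [x, y] \<Rightarrow> Some (f x y) | _ \<Rightarrow> None)"

text \<open>Kleene's partial recursive functions relative to a list of oracles. A program is a finite
  object that does not contain its oracles, so that one program running with varying oracles is a
  uniform computation from these oracles.\<close>

datatype prog =
    Zero
  | Succ
  | Proj nat
  | Oracle nat
  | Comp prog "prog list"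
  | PrimRec prog prog
  | Mu prog

inductive evaluates :: "pfun list \<Rightarrow> prog \<Rightarrow> nat list \<Rightarrow> nat \<Rightarrow> bool" for os where
  zero: "evaluates os Zero xs 0"
| succ: "evaluates os Succ [x] (Suc x)"
| proj: "i < length xs \<Longrightarrow> evaluates os (Proj i) xs (xs ! i)"
| query: "i < length os \<Longrightarrow> (os ! i) xs = Some y \<Longrightarrow> evaluates os (Oracle i) xs y"
| comp: "list_all2 (\<lambda>q y. evaluates os q xs y) qs ys \<Longrightarrow> evaluates os p ys z
    \<Longrightarrow> evaluates os (Comp p qs) xs z"
| primrec_0: "evaluates os p xs y \<Longrightarrow> evaluates os (PrimRec p q) (0 # xs) y"
| primrec_Suc: "evaluates os (PrimRec p q) (n # xs) y \<Longrightarrow> evaluates os q (n # y # xs) z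
    \<Longrightarrow> evaluates os (PrimRec p q) (Suc n # xs) z"
| mu: "evaluates os p (n # xs) 0 \<Longrightarrow> (\<And>m. m < n \<Longrightarrow> \<exists>k. evaluates os p (m # xs) (Suc k))
    \<Longrightarrow> evaluates os (Mu p) xs n"

definition computes_from :: "prog \<Rightarrow> pfun list \<Rightarrow> pfun \<Rightarrow> bool" where
  "computes_from p os F \<longleftrightarrow> (\<forall>xs y. F xs = Some y \<longrightarrow> evaluates os p xs y)"

definition recursive :: "pfun \<Rightarrow> bool" where
  "recursive F \<longleftrightarrow> (\<exists>p. computes_from p [] F)"

text \<open>The function \<open>x \<mapsto> [P x]\<close>, with truth values 1 (true) and 0 (false).\<close>

definition truth_value :: "(nat \<Rightarrow> bool) \<Rightarrow> nat \<Rightarrow> nat" where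
  "truth_value P x = of_bool (P x)"

definition decides :: "(nat \<Rightarrow> nat \<Rightarrow> nat) \<Rightarrow> nat rel \<Rightarrow> bool" where
  "decides \<pi> E \<longleftrightarrow> (\<forall>x y. \<pi> x y = of_bool ((x, y) \<in> E))"

definition equiv_decided_by :: "nat rel \<Rightarrow> (nat \<Rightarrow> nat \<Rightarrow> nat) \<Rightarrow> bool" where
  "equiv_decided_by E \<pi> \<longleftrightarrow> equiv UNIV E \<and> recursive (binary \<pi>) \<and> decides \<pi> E"

text \<open>Integer iterates; meaningful for bijective functions.\<close>

definition int_iter :: "('a \<Rightarrow> 'a) \<Rightarrow> int \<Rightarrow> 'a \<Rightarrow> 'a" where
  "int_iter f k = (if k \<ge> 0 then f ^^ nat k else inv f ^^ nat (- k))"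

definition cycle_of :: "('a \<Rightarrow> 'a) \<Rightarrow> 'a \<Rightarrow> 'a set" where
  "cycle_of f x = {int_iter f k x | k. True}"

definition cycles :: "('a \<Rightarrow> 'a) \<Rightarrow> 'a set set" where
  "cycles f = range (cycle_of f)"

definition recursive_perm_for :: "nat rel \<Rightarrow> (nat \<Rightarrow> nat) \<Rightarrow> bool" where
  "recursive_perm_for E f \<longleftrightarrow> recursive (unary f) \<and> bij f \<and> cycles f = UNIV // E"

definition permutable :: "nat rel \<Rightarrow> bool" where
  "permutable E \<longleftrightarrow> (\<exists>f. recursive_perm_for E f)"

definition delta :: "int \<Rightarrow> nat" where
  "delta k = (if k \<ge> 0 then nat (2 * k) else nat (- 2 * k - 1))"

text \<open>The set \<open>{j. infinite C \<or> j < card C}\<close> is \<open>{j. j < n}\<close> for the possibly infinite length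
  \<open>n\<close> of the cycle \<open>C\<close> (\<^term>\<open>card\<close> being 0 on infinite sets).\<close>

definition normal :: "(nat \<Rightarrow> nat) \<Rightarrow> bool" where
  "normal g \<longleftrightarrow> bij g \<and> (\<forall>C \<in> cycles g.
     strict_mono_on {j. infinite C \<or> j < card C}
       (\<lambda>j. int_iter g (inv delta j) (LEAST a. a \<in> C)))"

definition rho :: "nat rel \<Rightarrow> nat \<Rightarrow> bool" where
  "rho E x \<longleftrightarrow> (\<exists>x' > x. (x', x) \<in> E)"

end

theory Submission
  imports Defs
begin

text \<open>If the cycles of \<open>f\<close> are the classes, then the values \<open>f x, f (f x), \<dots>\<close> cannot all lie below
  \<open>x\<close>, since some value would repeat and injectivity would bring the orbit back to \<open>x\<close>. The first
  one that is at least \<open>x\<close> either exceeds \<open>x\<close>, a witness for \<open>\<rho>(x)\<close>, or equals \<open>x\<close>, and then the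
  whole cycle has been seen.

  Conversely, number the elements of each class increasingly from 0. The normal permutation sends
  number \<open>j\<close> to \<open>j + 2\<close> if \<open>j\<close> is even and to \<open>j - 2\<close> if \<open>j\<close> is odd, except that \<open>1\<close> goes to \<open>0\<close> and
  that the last even number goes to the last odd one. As \<open>\<rho>\<close> recognises the last element of a
  class, the graph of this permutation is decidable from \<open>\<pi>\<close> and \<open>\<rho>\<close>.\<close>

section \<open>Programs\<close>

text \<open>A query passes on its whole argument list, so the substituted program can take its place
  without rearranging arguments. With as many programs as oracles, an evaluation never reaches an
  index beyond \<open>ps\<close>.\<close>

primrec subst_oracles :: "prog list \<Rightarrow> prog \<Rightarrow> prog" where
  "subst_oracles ps Zero = Zero"
| "subst_oracles ps Succ = Succ"
| "subst_oracles ps (Proj i) = Proj i"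
| "subst_oracles ps (Oracle i) = ps ! i"
| "subst_oracles ps (Comp p qs) = Comp (subst_oracles ps p) (map (subst_oracles ps) qs)"
| "subst_oracles ps (PrimRec p q) = PrimRec (subst_oracles ps p) (subst_oracles ps q)"
| "subst_oracles ps (Mu p) = Mu (subst_oracles ps p)"

lemma evaluates_subst_oracles:
  assumes "evaluates os p xs y"
    and ps: "list_all2 (\<lambda>q F. computes_from q os' F) ps os"
  shows "evaluates os' (subst_oracles ps p) xs y"
  using assms(1)
proof induction
  case (query i xs y)
  then show ?case
    using ps by (auto simp: computes_from_def list_all2_conv_all_nth)
next
  case (comp xs qs ys p z)
  have "list_all2 (\<lambda>q y. evaluates os' q xs y) (map (subst_oracles ps) qs) ys"
    using comp.IH(1) by (auto simp: list.rel_map elim: list_all2_mono)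
  then show ?case
    using comp.IH(2) by (auto intro: evaluates.comp)
next
  case (mu p n xs)
  then show ?case
    by (auto intro!: evaluates.mu)
qed (auto intro: evaluates.intros)

text \<open>Each recursive oracle has an oracle-free program, and putting these in place of the
  queries leaves a program without oracles.\<close>

lemma recursive_if_computes_from:
  assumes "computes_from p os F" "list_all recursive os"
  shows "recursive F"
proof -
  have "\<exists>q. computes_from q [] G" if "G \<in> set os" for G
    using assms(2) that by (auto simp: list_all_iff recursive_def)
  then obtain q where "\<And>G. G \<in> set os \<Longrightarrow> computes_from (q G) [] G"
    by metis
  then have "list_all2 (\<lambda>q F. computes_from q [] F) (map q os) os"
    by (simp add: list.rel_map list.rel_refl_strong)
  then have "computes_from (subst_oracles (map q os) p) [] F"
    using assms(1) evaluates_subst_oracles unfolding computes_from_def by blast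
  then show ?thesis
    by (auto simp: recursive_def)
qed

lemma computes_from_unary:
  "computes_from p os (unary F) \<longleftrightarrow> (\<forall>x. evaluates os p [x] (F x))"
  by (fastforce simp: computes_from_def unary_def split: list.splits)

lemma evaluates_Proj: "i < length xs \<Longrightarrow> xs ! i = y \<Longrightarrow> evaluates os (Proj i) xs y"
  using evaluates.proj by blast

lemma evaluates_Comp1:
  "evaluates os q xs a \<Longrightarrow> evaluates os p [a] z \<Longrightarrow> evaluates os (Comp p [q]) xs z"
  by (rule evaluates.comp[where ys = "[a]"]) auto

lemma evaluates_Comp2:
  "evaluates os q xs a \<Longrightarrow> evaluates os r xs b \<Longrightarrow> evaluates os p [a, b] z \<Longrightarrow>
    evaluates os (Comp p [q, r]) xs z"
  by (rule evaluates.comp[where ys = "[a, b]"]) auto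

lemma evaluates_PrimRec:
  assumes "evaluates os p xs (g 0)" "\<And>n. evaluates os q (n # g n # xs) (g (Suc n))"
  shows "evaluates os (PrimRec p q) (n # xs) (g n)"
  by (induction n) (auto intro: evaluates.intros assms)

text \<open>Totality of \<open>p\<close> in the search variable is what makes every value below the
  least zero available, and positive.\<close>

lemma evaluates_Mu:
  assumes "\<And>n. evaluates os p (n # xs) (g n)" "g n = 0"
  shows "evaluates os (Mu p) xs (LEAST n. g n = 0)"
proof (rule evaluates.mu)
  show "evaluates os p ((LEAST n. g n = 0) # xs) 0"
    using assms(1)[of "LEAST n. g n = 0"] LeastI[of "\<lambda>n. g n = 0", OF assms(2)] by simp
  show "\<exists>k. evaluates os p (m # xs) (Suc k)" if "m < (LEAST n. g n = 0)" for m
    using assms(1)[of m] not_less_Least[OF that] by (metis not0_implies_Suc)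
qed

section \<open>Arithmetic on the values of programs\<close>

definition Plus :: "prog \<Rightarrow> prog \<Rightarrow> prog" where
  "Plus p q = Comp (PrimRec (Proj 0) (Comp Succ [Proj 1])) [p, q]"

definition Times :: "prog \<Rightarrow> prog \<Rightarrow> prog" where
  "Times p q = Comp (PrimRec Zero (Plus (Proj 1) (Proj 2))) [p, q]"

text \<open>Truncated subtraction. The recursion runs on the subtrahend, hence the swapped
  arguments; the inner \<open>PrimRec Zero (Proj 0)\<close> is the predecessor, with 0 sent to
  0.\<close>

definition Minus :: "prog \<Rightarrow> prog \<Rightarrow> prog" where
  "Minus p q = Comp (PrimRec (Proj 0) (Comp (PrimRec Zero (Proj 0)) [Proj 1])) [q, p]"

definition Is_zero :: "prog \<Rightarrow> prog" where
  "Is_zero p = Minus (Comp Succ [Zero]) p"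

definition Parity :: "prog \<Rightarrow> prog" where
  "Parity p = Comp (PrimRec Zero (Is_zero (Proj 1))) [p]"

text \<open>Both differences being truncated, this is the absolute difference. It is 0 exactly on
  equality and so serves as an equality test.\<close>

definition Dist :: "prog \<Rightarrow> prog \<Rightarrow> prog" where
  "Dist p q = Plus (Minus p q) (Minus q p)"

definition Iterate :: "prog \<Rightarrow> prog \<Rightarrow> prog \<Rightarrow> prog" where
  "Iterate p q r = Comp (PrimRec (Proj 0) (Comp p [Proj 1])) [q, r]"

lemma evaluates_Succ: "evaluates os p xs a \<Longrightarrow> evaluates os (Comp Succ [p]) xs (Suc a)"
  using evaluates_Comp1 evaluates.succ by blast

lemma evaluates_Plus:
  assumes "evaluates os p xs a" "evaluates os q xs b"
  shows "evaluates os (Plus p q) xs (a + b)"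
  unfolding Plus_def
  by (rule evaluates_Comp2[OF assms], rule evaluates_PrimRec[where g = "\<lambda>n. n + b"])
    (auto intro!: evaluates_Succ evaluates_Proj)

lemma evaluates_Times:
  assumes "evaluates os p xs a" "evaluates os q xs b"
  shows "evaluates os (Times p q) xs (a * b)"
proof -
  have "evaluates os (Plus (Proj 1) (Proj 2)) [n, n * b, b] (n * b + b)" for n
    by (intro evaluates_Plus evaluates_Proj) auto
  then show ?thesis
    unfolding Times_def
    by (intro evaluates_Comp2[OF assms] evaluates_PrimRec[where g = "\<lambda>n. n * b"])
      (auto intro: evaluates.zero simp: add.commute)
qed

lemma evaluates_Minus:
  assumes "evaluates os p xs a" "evaluates os q xs b"
  shows "evaluates os (Minus p q) xs (a - b)"
proof -
  have pred: "evaluates os (PrimRec Zero (Proj 0)) [n] (n - 1)" for n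
    by (rule evaluates_PrimRec) (auto intro: evaluates.zero evaluates_Proj)
  have "evaluates os (Comp (PrimRec Zero (Proj 0)) [Proj 1]) [n, a - n, a] (a - n - 1)" for n
    by (rule evaluates_Comp1[OF _ pred]) (auto intro: evaluates_Proj)
  then show ?thesis
    unfolding Minus_def
    by (intro evaluates_Comp2[OF assms(2,1)] evaluates_PrimRec[where g = "\<lambda>n. a - n"])
      (auto intro: evaluates_Proj)
qed

lemma evaluates_Is_zero:
  "evaluates os p xs a \<Longrightarrow> evaluates os (Is_zero p) xs (of_bool (a = 0))"
  using evaluates_Minus[OF evaluates_Succ[OF evaluates.zero]] unfolding Is_zero_def
  by (cases a) fastforce+

lemma evaluates_Parity:
  assumes "evaluates os p xs a"
  shows "evaluates os (Parity p) xs (a mod 2)"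
proof -
  have "evaluates os (Is_zero (Proj 1)) [n, n mod 2] (of_bool (n mod 2 = 0))" for n
    by (intro evaluates_Is_zero evaluates_Proj) auto
  moreover have "of_bool (n mod 2 = 0) = Suc n mod 2" for n
    by (auto simp: mod2_eq_if)
  ultimately show ?thesis
    unfolding Parity_def
    by (intro evaluates_Comp1[OF assms] evaluates_PrimRec[where g = "\<lambda>n. n mod 2"])
      (auto intro: evaluates.zero)
qed

lemma evaluates_Dist:
  "evaluates os p xs a \<Longrightarrow> evaluates os q xs b \<Longrightarrow>
    evaluates os (Dist p q) xs ((a - b) + (b - a))"
  unfolding Dist_def by (intro evaluates_Plus evaluates_Minus)

lemma evaluates_Iterate:
  assumes "\<And>x. evaluates os p [x] (f x)" "evaluates os q xs n" "evaluates os r xs a"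
  shows "evaluates os (Iterate p q r) xs ((f ^^ n) a)"
proof -
  have "evaluates os (Comp p [Proj 1]) [m, (f ^^ m) a, a] ((f ^^ Suc m) a)" for m
    by (rule evaluates_Comp1[where a = "(f ^^ m) a"]) (auto intro: evaluates_Proj assms(1))
  then show ?thesis
    unfolding Iterate_def
    by (intro evaluates_Comp2[OF assms(2,3)] evaluates_PrimRec[where g = "\<lambda>m. (f ^^ m) a"])
      (auto intro: evaluates_Proj)
qed

lemma evaluates_Oracle_unary:
  assumes "i < length os" "os ! i = unary f"
  shows "evaluates os (Oracle i) [x] (f x)"
  using assms by (auto intro: evaluates.query simp: unary_def)

lemma evaluates_Oracle_binary:
  assumes "i < length os" "os ! i = binary f"
  shows "evaluates os (Oracle i) [x, y] (f x y)"
  using assms by (auto intro: evaluates.query simp: binary_def)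

section \<open>Cycles\<close>

text \<open>For negative \<open>k\<close>, the outermost \<open>inv f\<close> cancels against
  \<open>f\<close> by surjectivity.\<close>

lemma int_iter_plus_1:
  assumes "bij f"
  shows "int_iter f (k + 1) x = f (int_iter f k x)"
proof (cases "k \<ge> 0")
  case True
  then have "nat (k + 1) = Suc (nat k)"
    by simp
  with True show ?thesis
    by (simp add: int_iter_def)
next
  case False
  then obtain m where "k = - int (Suc m)"
    by (metis int_cases not_le of_nat_0_le_iff)
  then show ?thesis
    using surj_f_inv_f[OF bij_is_surj[OF assms]] by (cases m) (auto simp: int_iter_def nat_add_distrib)
qed

lemma self_in_cycle_of: "x \<in> cycle_of f x"
  unfolding cycle_of_def by (auto simp: int_iter_def intro: exI[of _ 0])

lemma funpow_in_cycle_of: "(f ^^ n) x \<in> cycle_of f x"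
  unfolding cycle_of_def by (auto simp: int_iter_def intro!: exI[of _ "int n"])

lemma image_in_cycle_of_iff:
  assumes "bij f"
  shows "f y \<in> cycle_of f x \<longleftrightarrow> y \<in> cycle_of f x"
proof
  assume "f y \<in> cycle_of f x"
  \<comment> \<open>Writing the exponent as \<open>(k - 1) + 1\<close> exposes an outer
    \<open>f\<close>, which injectivity removes.\<close>
  then obtain k where "f y = int_iter f ((k - 1) + 1) x"
    by (auto simp: cycle_of_def)
  then have "y = int_iter f (k - 1) x"
    using bij_is_inj[OF assms] unfolding int_iter_plus_1[OF assms] by (rule injD[rotated])
  then show "y \<in> cycle_of f x"
    by (auto simp: cycle_of_def)
next
  assume "y \<in> cycle_of f x"
  then show "f y \<in> cycle_of f x"
    using int_iter_plus_1[OF assms, symmetric] by (auto simp: cycle_of_def)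
qed

lemma cycle_of_eq_class:
  assumes "cycles f = UNIV // E" "equiv UNIV E"
  shows "cycle_of f x = E `` {x}"
proof -
  have "cycle_of f x \<in> UNIV // E"
    using assms(1) by (auto simp: cycles_def)
  with assms(2) self_in_cycle_of[of x f] show ?thesis
    by (metis Image_singleton_iff UNIV_I equiv_class_eq_iff quotientE)
qed

text \<open>On a periodic point, negative iterates are also nonnegative ones, and exponents reduce
  modulo \<open>n\<close>.\<close>

lemma cycle_of_periodic:
  assumes "bij f" "n > 0" "(f ^^ n) x = x" "y \<in> cycle_of f x"
  shows "\<exists>m<n. y = (f ^^ m) x"
proof -
  have "\<exists>m. y = (f ^^ m) x"
  proof -
    obtain k where k: "y = int_iter f k x"
      using assms(4) by (auto simp: cycle_of_def)
    show ?thesis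
    proof (cases "k \<ge> 0")
      case True
      then show ?thesis
        using k by (auto simp: int_iter_def)
    next
      case False
      define m where "m = nat (- k)"
      have "m \<le> m * n"
        using assms(2) by simp
      \<comment> \<open>A multiple of the period that is at least \<open>m\<close>: going back
        \<open>m\<close> steps is going forward \<open>m * n - m\<close> steps.\<close>
      have "(f ^^ (m * n)) x = x"
        using funpow_mod_eq[OF assms(3), of "m * n"] by simp
      then have "(f ^^ m) ((f ^^ (m * n - m)) x) = x"
        using \<open>m \<le> m * n\<close> by (metis comp_apply funpow_add le_add_diff_inverse)
      then have "(inv f ^^ m) x = (f ^^ (m * n - m)) x"
        using inv_fn_o_fn_is_id[OF assms(1), of m] by (metis comp_apply)
      then show ?thesis
        using k False by (auto simp: int_iter_def m_def)
    qed
  qed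
  then obtain m where "y = (f ^^ (m mod n)) x"
    using funpow_mod_eq[OF assms(3)] by metis
  then show ?thesis
    using assms(2) mod_less_divisor by blast
qed

section \<open>From a permutation to the predicate\<close>

text \<open>Starting at exponent \<open>Suc n\<close> excludes the trivial return at exponent
  0.\<close>

lemma ex_return:
  fixes f :: "nat \<Rightarrow> nat"
  assumes "inj f"
  shows "\<exists>n. x \<le> (f ^^ Suc n) x"
proof (rule ccontr)
  assume *: "\<nexists>n. x \<le> (f ^^ Suc n) x"
  then have "range (\<lambda>n. (f ^^ Suc n) x) \<subseteq> {..<x}"
    by (auto simp: not_le)
  then have "\<not> inj (\<lambda>n. (f ^^ Suc n) x)"
    using finite_subset infinite_UNIV_nat finite_imageD by blast
  then obtain i j where "i < j" "(f ^^ Suc i) x = (f ^^ Suc j) x"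
    by (meson linorder_injI)
  then have "(f ^^ Suc i) x = (f ^^ Suc i) ((f ^^ (j - i)) x)"
    using fun_cong[OF funpow_add[of "Suc i" "j - i" f], of x] by simp
  then have "(f ^^ (j - i)) x = x"
    using inj_fn[OF assms, of "Suc i"] by (metis injD)
  moreover have "j - i = Suc (j - i - 1)"
    using \<open>i < j\<close> by simp
  ultimately have "x \<le> (f ^^ Suc (j - i - 1)) x"
    by (metis order_refl)
  with * show False
    by blast
qed

text \<open>If the first return hits \<open>x\<close> itself, the cycle consists of \<open>x\<close>
  and the earlier iterates, all below \<open>x\<close> by minimality.\<close>

lemma rho_iff_first_return:
  assumes E: "equiv UNIV E" and f: "bij f" "cycles f = UNIV // E"
    and n: "n = (LEAST n. x \<le> (f ^^ Suc n) x)"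
  shows "rho E x \<longleftrightarrow> x < (f ^^ Suc n) x"
proof
  assume "x < (f ^^ Suc n) x"
  moreover have "((f ^^ Suc n) x, x) \<in> E"
    using funpow_in_cycle_of[of "Suc n" f x] cycle_of_eq_class[OF f(2) E] E
    by (metis Image_singleton_iff equivE symE)
  ultimately show "rho E x"
    by (auto simp: rho_def)
next
  assume "rho E x"
  then obtain x' where x': "x' > x" "x' \<in> cycle_of f x"
    using cycle_of_eq_class[OF f(2) E] E
    by (metis Image_singleton_iff equivE rho_def symE)
  have "x \<le> (f ^^ Suc n) x"
    unfolding n using ex_return[OF bij_is_inj[OF f(1)]] by (rule LeastI_ex)
  moreover have "(f ^^ Suc n) x \<noteq> x"
  proof
    assume "(f ^^ Suc n) x = x"
    then obtain m where m: "m < Suc n" "x' = (f ^^ m) x"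
      using cycle_of_periodic[OF f(1) _ _ x'(2)] by blast
    \<comment> \<open>Exponent 0 would give \<open>x' = x\<close>; otherwise \<open>i < n\<close>,
      so minimality puts \<open>x'\<close> below \<open>x\<close>.\<close>
    with x'(1) obtain i where "m = Suc i"
      by (cases m) auto
    with m x'(1) not_less_Least[of i "\<lambda>n. x \<le> (f ^^ Suc n) x"] show False
      by (auto simp: n)
  qed
  ultimately show "x < (f ^^ Suc n) x"
    by simp
qed

text \<open>\<open>it\<close> takes \<open>[n, x]\<close> to the iterate with exponent
  \<open>Suc n\<close>. The search finds the first return; the doubled \<open>Is_zero\<close> turns
  a positive excess over \<open>x\<close> into 1.\<close>

definition rho_prog :: "prog \<Rightarrow> prog" where
  "rho_prog p =
    (let it = Iterate p (Comp Succ [Proj 0]) (Proj 1)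
     in Comp (Is_zero (Is_zero (Minus it (Proj 1)))) [Mu (Minus (Proj 1) it), Proj 0])"

lemma computes_from_rho_prog:
  assumes E: "equiv UNIV E" and f: "recursive_perm_for E f"
    and p: "\<And>x. evaluates os p [x] (f x)"
  shows "computes_from (rho_prog p) os (unary (truth_value (rho E)))"
  unfolding computes_from_unary
proof
  fix x
  have f': "bij f" "cycles f = UNIV // E"
    using f by (auto simp: recursive_perm_for_def)
  define n where "n = (LEAST n. x \<le> (f ^^ Suc n) x)"
  let ?it = "Iterate p (Comp Succ [Proj 0]) (Proj 1)"
  have it: "evaluates os ?it [m, x] ((f ^^ Suc m) x)" for m
    by (intro evaluates_Iterate evaluates_Succ evaluates_Proj p) auto
  have "evaluates os (Mu (Minus (Proj 1) ?it)) [x] (LEAST n. x - (f ^^ Suc n) x = 0)"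
    using ex_return[OF bij_is_inj[OF f'(1)], of x]
    by (elim exE, intro evaluates_Mu evaluates_Minus it evaluates_Proj) auto
  then have mu: "evaluates os (Mu (Minus (Proj 1) ?it)) [x] n"
    by (simp only: n_def diff_is_0_eq)
  have "evaluates os (Is_zero (Is_zero (Minus ?it (Proj 1)))) [n, x]
      (of_bool (of_bool ((f ^^ Suc n) x - x = 0) = (0 :: nat)))"
    by (intro evaluates_Is_zero evaluates_Minus it evaluates_Proj) auto
  also have "of_bool (of_bool ((f ^^ Suc n) x - x = 0) = (0 :: nat)) = truth_value (rho E) x"
    using rho_iff_first_return[OF E f' n_def] by (auto simp: truth_value_def)
  finally show "evaluates os (rho_prog p) [x] (truth_value (rho E) x)"
    unfolding rho_prog_def Let_def
    by (intro evaluates_Comp2[OF mu]) (auto intro: evaluates_Proj)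
qed

section \<open>From the predicate to a permutation\<close>

definition index :: "nat rel \<Rightarrow> nat \<Rightarrow> nat" where
  "index E x = card {z. z < x \<and> (z, x) \<in> E}"

text \<open>The graph of the normal permutation. Truncated subtraction handles the small cases: rank
  1 goes to \<open>1 - 2 = 0\<close>, and the sole element of a singleton class goes to
  \<open>0 - 1 = 0\<close>, itself.\<close>

definition step :: "nat rel \<Rightarrow> nat \<Rightarrow> nat \<Rightarrow> bool" where
  "step E x y \<longleftrightarrow> (x, y) \<in> E \<and>
    (if even (index E x)
     then index E y = index E x + 2
       \<or> index E y = index E x + 1 \<and> \<not> rho E y
       \<or> index E y = index E x - 1 \<and> \<not> rho E x
     else index E y = index E x - 2)"

context
  fixes E :: "nat rel"
  assumes E: "equiv UNIV E"
begin

section \<open>Ranks of elements within their classes\<close>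

lemma E_refl: "(x, x) \<in> E"
  using E by (simp add: equiv_def refl_on_def)

lemma E_sym: "(x, y) \<in> E \<Longrightarrow> (y, x) \<in> E"
  using E by (meson equivE symE)

lemma E_trans: "(x, y) \<in> E \<Longrightarrow> (y, z) \<in> E \<Longrightarrow> (x, z) \<in> E"
  using E by (meson equivE transE)

lemma index_less:
  assumes "(x, y) \<in> E" "x < y"
  shows "index E x < index E y"
  unfolding index_def
proof (rule psubset_card_mono)
  show "finite {z. z < y \<and> (z, y) \<in> E}"
    by simp
  show "{z. z < x \<and> (z, x) \<in> E} \<subset> {z. z < y \<and> (z, y) \<in> E}"
    using assms E_trans[of _ x y] by auto
qed

lemma index_less_iff: "(x, y) \<in> E \<Longrightarrow> index E x < index E y \<longleftrightarrow> x < y"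
  using index_less[of x y] index_less[of y x] E_sym[of x y]
  by (cases x y rule: linorder_cases) auto

lemma index_inj: "(x, y) \<in> E \<Longrightarrow> index E x = index E y \<Longrightarrow> x = y"
  using index_less[of x y] index_less[of y x] E_sym[of x y]
  by (cases x y rule: linorder_cases) auto

text \<open>The next larger element of the class has exactly one more predecessor in it, namely
  \<open>x\<close>.\<close>

lemma index_Suc:
  assumes "rho E x"
  shows "\<exists>y. (x, y) \<in> E \<and> index E y = Suc (index E x)"
proof -
  define y where "y = (LEAST y. y > x \<and> (y, x) \<in> E)"
  have y: "y > x \<and> (y, x) \<in> E"
    using assms unfolding y_def rho_def by (rule LeastI_ex)
  have min: "z \<le> x" if "z < y" "(z, x) \<in> E" for z
    using not_less_Least[of z "\<lambda>y. y > x \<and> (y, x) \<in> E"] that by (auto simp: y_def)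
  have "{z. z < y \<and> (z, y) \<in> E} = insert x {z. z < x \<and> (z, x) \<in> E}"
  proof (intro set_eqI iffI)
    fix z
    assume "z \<in> {z. z < y \<and> (z, y) \<in> E}"
    then have "z < y" "(z, x) \<in> E"
      using y E_trans by blast+
    then show "z \<in> insert x {z. z < x \<and> (z, x) \<in> E}"
      using min[of z] by auto
  next
    fix z
    assume "z \<in> insert x {z. z < x \<and> (z, x) \<in> E}"
    then show "z \<in> {z. z < y \<and> (z, y) \<in> E}"
      using y E_sym[of y x] E_trans[of z x y] by auto
  qed
  then have "index E y = Suc (index E x)"
    by (simp add: index_def)
  then show ?thesis
    using y E_sym by blast
qed

text \<open>Ranks have no gaps: starting from the least element of the class, an element of rank
  below that of \<open>x\<close> lies below \<open>x\<close>, hence has a successor in the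
  class.\<close>

lemma ex_index:
  assumes "i \<le> index E x"
  shows "\<exists>y. (x, y) \<in> E \<and> index E y = i"
  using assms
proof (induction i)
  case 0
  define y where "y = (LEAST y. (x, y) \<in> E)"
  have "(x, y) \<in> E"
    unfolding y_def using E_refl by (rule LeastI)
  moreover have "\<not> (z < y \<and> (z, y) \<in> E)" for z
    using not_less_Least[of z "\<lambda>y. (x, y) \<in> E"] calculation E_trans E_sym
    unfolding y_def[symmetric] by blast
  then have "index E y = 0"
    by (simp add: index_def)
  ultimately show ?case
    by blast
next
  case (Suc i)
  then obtain y where y: "(x, y) \<in> E" "index E y = i"
    by auto
  then have "y < x"
    using Suc.prems index_less_iff[of y x] E_sym by auto
  then have "rho E y"
    using y by (auto simp: rho_def)
  then show ?case
    using index_Suc y E_trans by metis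
qed

lemma index_le_if_not_rho: "\<not> rho E x \<Longrightarrow> (x, y) \<in> E \<Longrightarrow> index E y \<le> index E x"
  using index_less_iff[of x y] E_sym[of x y] by (auto simp: rho_def intro: leI)

section \<open>The step relation is the graph of a bijection\<close>

lemma step_total: "\<exists>y. step E x y"
proof (cases "even (index E x)")
  case True
  show ?thesis
  proof (cases "rho E x")
    case rho: True
    then obtain y where y: "(x, y) \<in> E" "index E y = Suc (index E x)"
      using index_Suc by blast
    show ?thesis
    proof (cases "rho E y")
      case True
      then obtain z where "(y, z) \<in> E" "index E z = Suc (index E y)"
        using index_Suc by blast
      then have "step E x z"
        using \<open>even (index E x)\<close> y E_trans[of x y z] by (simp add: step_def)
      then show ?thesis ..
    next
      case False
      then have "step E x y"
        using \<open>even (index E x)\<close> y by (simp add: step_def)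
      then show ?thesis ..
    qed
  next
    case False
    \<comment> \<open>Here \<open>x\<close> is last and goes one rank down, or stays fixed if its
      rank is 0.\<close>
    then show ?thesis
      using True ex_index[of "index E x - 1" x] by (auto simp: step_def)
  qed
next
  case False
  then show ?thesis
    using ex_index[of "index E x - 2" x] by (auto simp: step_def)
qed

lemma step_surj: "\<exists>x. step E x y"
proof (cases "even (index E y)")
  case True
  show ?thesis
  proof (cases "index E y = 0")
    case zero: True
    show ?thesis
    proof (cases "rho E y")
      case True
      then obtain x where "(y, x) \<in> E" "index E x = Suc (index E y)"
        using index_Suc by blast
      \<comment> \<open>\<open>x\<close> has rank 1, and the truncated \<open>1 - 2\<close> is
        0.\<close>
      then have "step E x y"
        using zero E_sym by (simp add: step_def)
      then show ?thesis ..
    next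
      case False
      then have "step E y y"
        using zero E_refl by (simp add: step_def)
      then show ?thesis ..
    qed
  next
    case False
    obtain x where "(y, x) \<in> E" "index E x = index E y - 2"
      using ex_index[of "index E y - 2" y] by auto
    then have "step E x y"
      using True False E_sym by (auto simp: step_def elim!: evenE)
    then show ?thesis ..
  qed
next
  case odd: False
  show ?thesis
  proof (cases "rho E y")
    case True
    then obtain x where x: "(y, x) \<in> E" "index E x = Suc (index E y)"
      using index_Suc by blast
    show ?thesis
    proof (cases "rho E x")
      case True
      then obtain z where "(x, z) \<in> E" "index E z = Suc (index E x)"
        using index_Suc by blast
      then have "step E z y"
        using odd x E_trans[of y x z] E_sym[of y z] by (simp add: step_def)
      then show ?thesis ..
    next
      case False
      \<comment> \<open>\<open>x\<close> is last and of even rank, so it goes one rank down.\<close>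
      then have "step E x y"
        using odd x E_sym by (simp add: step_def)
      then show ?thesis ..
    qed
  next
    case False
    \<comment> \<open>As \<open>y\<close> is last and of odd rank, it is reached from the even rank
      just below.\<close>
    obtain x where "(y, x) \<in> E" "index E x = index E y - 1"
      using ex_index[of "index E y - 1" y] by auto
    then have "step E x y"
      using odd False E_sym by (auto simp: step_def elim!: oddE)
    then show ?thesis ..
  qed
qed

text \<open>Within a class the rank determines the element. A last element bounds all ranks of its
  class, which makes the alternatives for an even rank exclude one another.\<close>

lemma step_functional:
  assumes "step E x y" "step E x z"
  shows "y = z"
proof (rule index_inj)
  have "(x, y) \<in> E" "(x, z) \<in> E"
    using assms by (auto simp: step_def)
  then show "(y, z) \<in> E"
    using E_sym E_trans by blast
  then show "index E y = index E z"
    using assms index_le_if_not_rho[of x y] index_le_if_not_rho[of x z]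
      index_le_if_not_rho[of y z] index_le_if_not_rho[of z y] E_sym
    by (auto simp: step_def split: if_splits)
qed

lemma step_injective:
  assumes "step E x z" "step E y z"
  shows "x = y"
proof (rule index_inj)
  have *: "(x, z) \<in> E" "(y, z) \<in> E"
    using assms by (auto simp: step_def)
  then show "(x, y) \<in> E"
    using E_sym E_trans by blast
  \<comment> \<open>All bounds that a last element among \<open>x\<close>, \<open>y\<close>,
    \<open>z\<close> puts on the other ranks. With parity, the rest is arithmetic of three
    numbers.\<close>
  with * have "\<not> rho E u \<Longrightarrow> v \<in> {x, y, z} \<Longrightarrow> index E v \<le> index E u" if "u \<in> {x, y, z}" for u v
    using that index_le_if_not_rho E_sym E_refl by auto
  then have "\<not> rho E x \<Longrightarrow> index E y \<le> index E x \<and> index E z \<le> index E x"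
    "\<not> rho E y \<Longrightarrow> index E x \<le> index E y \<and> index E z \<le> index E y"
    "\<not> rho E z \<Longrightarrow> index E x \<le> index E z \<and> index E y \<le> index E z"
    by auto
  moreover have
    "if even (index E x)
     then index E z = index E x + 2
       \<or> index E z = index E x + 1 \<and> \<not> rho E z
       \<or> index E z = index E x - 1 \<and> \<not> rho E x
     else index E z = index E x - 2"
    "if even (index E y)
     then index E z = index E y + 2
       \<or> index E z = index E y + 1 \<and> \<not> rho E z
       \<or> index E z = index E y - 1 \<and> \<not> rho E y
     else index E z = index E y - 2"
    using assms unfolding step_def by blast+
  ultimately show "index E x = index E y"
    by (auto split: if_splits) presburger+
qed

text \<open>By \<open>step_functional\<close> there is just one such \<open>y\<close>; the form with
  \<open>LEAST\<close> matches the value that \<open>Mu step_prog\<close> returns.\<close>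

definition perm :: "nat \<Rightarrow> nat" where
  "perm x = (LEAST y. step E x y)"

lemma step_perm: "step E x (perm x)"
  unfolding perm_def using step_total by (rule LeastI_ex)

lemma perm_eqI: "step E x y \<Longrightarrow> perm x = y"
  by (rule step_functional[OF step_perm])

lemma bij_perm: "bij perm"
proof (rule bijI)
  show "inj perm"
    by (rule injI) (metis step_perm step_injective)
  show "surj perm"
    using step_surj perm_eqI by (metis surj_def)
qed

lemma perm_related: "(x, perm x) \<in> E"
  using step_perm by (auto simp: step_def)

text \<open>Invariance allows moving along \<open>perm\<close> in either direction, and one of them
  lowers a positive rank: backwards by two from an even rank, forwards from an odd one. Applied to a
  cycle, this shows that it contains a whole class or misses it.\<close>

lemma perm_invariant_descends:
  assumes "\<And>y. perm y \<in> S \<longleftrightarrow> y \<in> S"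
  shows "\<exists>z. (x, z) \<in> E \<and> index E z = 0 \<and> (x \<in> S \<longleftrightarrow> z \<in> S)"
proof (induction "index E x" arbitrary: x rule: less_induct)
  case less
  show ?case
  proof (cases "index E x = 0")
    case True
    then show ?thesis
      using E_refl by blast
  next
    case False
    have "\<exists>y. (x, y) \<in> E \<and> index E y < index E x \<and> (x \<in> S \<longleftrightarrow> y \<in> S)"
    proof (cases "even (index E x)")
      case True
      obtain y where y: "(x, y) \<in> E" "index E y = index E x - 2"
        using ex_index[of "index E x - 2" x] by auto
      then have "step E y x"
        using True False E_sym by (auto simp: step_def elim!: evenE)
      then have "x \<in> S \<longleftrightarrow> y \<in> S"
        using assms perm_eqI by blast
      then show ?thesis
        using y False by auto
    next
      case odd: False
      then have "index E (perm x) < index E x"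
        using step_perm[of x] False by (auto simp: step_def)
      then show ?thesis
        using assms perm_related by blast
    qed
    then show ?thesis
      using less E_trans by meson
  qed
qed

lemma cycle_of_perm: "cycle_of perm x = E `` {x}"
proof
  have rel: "(x, int_iter perm k x) \<in> E" for k
  proof (induction k rule: int_induct[where k = 0])
    case base
    then show ?case
      using E_refl by (simp add: int_iter_def)
  next
    case (step1 i)
    then show ?case
      using perm_related E_trans by (metis int_iter_plus_1[OF bij_perm])
  next
    case (step2 i)
    \<comment> \<open>The iterate with exponent \<open>i - 1\<close> is related to its image, so
      symmetry carries the relation one step back.\<close>
    have "int_iter perm i x = perm (int_iter perm (i - 1) x)"
      using int_iter_plus_1[OF bij_perm, of "i - 1"] by simp
    then show ?case
      using step2 perm_related E_trans E_sym by metis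
  qed
  then show "cycle_of perm x \<subseteq> E `` {x}"
    by (auto simp: cycle_of_def)
  show "E `` {x} \<subseteq> cycle_of perm x"
  proof
    fix y
    assume "y \<in> E `` {x}"
    then have y: "(x, y) \<in> E"
      by simp
    \<comment> \<open>The invariant set is the cycle of \<open>x\<close>. Both \<open>x\<close> and
      \<open>y\<close> descend to the unique element of rank 0 in their class.\<close>
    note descends = perm_invariant_descends[OF image_in_cycle_of_iff[OF bij_perm, of _ x]]
    obtain z where z: "(x, z) \<in> E" "index E z = 0"
        "x \<in> cycle_of perm x \<longleftrightarrow> z \<in> cycle_of perm x"
      using descends[of x] by blast
    obtain w where w: "(y, w) \<in> E" "index E w = 0"
        "y \<in> cycle_of perm x \<longleftrightarrow> w \<in> cycle_of perm x"
      using descends[of y] by blast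
    have "(z, w) \<in> E"
      using y z(1) w(1) E_sym E_trans by blast
    then have "z = w"
      using z(2) w(2) index_inj by simp
    then show "y \<in> cycle_of perm x"
      using z(3) w(3) self_in_cycle_of[of x "perm"] by simp
  qed
qed

lemma cycles_perm: "cycles perm = UNIV // E"
  unfolding cycles_def cycle_of_perm quotient_def by blast

end

section \<open>Programs for the rank and for the permutation\<close>

definition Index :: "prog \<Rightarrow> prog" where
  "Index p = Comp (PrimRec Zero (Plus (Proj 1) (Comp (Oracle 0) [Proj 0, Proj 2]))) [p, p]"

lemma evaluates_Index:
  assumes \<pi>: "decides \<pi> E" and os: "os = binary \<pi> # os'" and p: "evaluates os p xs x"
  shows "evaluates os (Index p) xs (index E x)"
proof -
  \<comment> \<open>Separating the bound \<open>n\<close> from the element \<open>x\<close> lets the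
    recursion run on \<open>n\<close> alone; \<open>Index\<close> then supplies \<open>x\<close> for
    both.\<close>
  define g where "g n = card {z. z < n \<and> (z, x) \<in> E}" for n
  have "{z. z < Suc n \<and> (z, x) \<in> E} =
      (if (n, x) \<in> E then insert n else id) {z. z < n \<and> (z, x) \<in> E}" for n
    by (auto simp: less_Suc_eq)
  then have Suc: "g (Suc n) = g n + \<pi> n x" for n
    using \<pi> by (simp add: g_def decides_def)
  have "evaluates os (Plus (Proj 1) (Comp (Oracle 0) [Proj 0, Proj 2])) [n, g n, x] (g (Suc n))"
    for n
    unfolding Suc
    by (intro evaluates_Plus evaluates_Comp2[where a = n and b = x] evaluates_Oracle_binary
        evaluates_Proj) (auto simp: os)
  then have "evaluates os (PrimRec Zero (Plus (Proj 1) (Comp (Oracle 0) [Proj 0, Proj 2])))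
      [x, x] (g x)"
    by (intro evaluates_PrimRec) (auto simp: g_def intro: evaluates.zero)
  then show ?thesis
    unfolding Index_def index_def g_def by (rule evaluates_Comp2[OF p p])
qed

text \<open>The argument list is \<open>[y, x]\<close>. The value 0 means true, so that \<^const>\<open>Plus\<close> is conjunction
  and \<^const>\<open>Times\<close> is disjunction.\<close>

definition step_prog :: prog where
  "step_prog =
    (let i = Index (Proj 1); j = Index (Proj 0); one = Comp Succ [Zero]; two = Comp Succ [one]
     in Plus (Is_zero (Comp (Oracle 0) [Proj 1, Proj 0]))
       (Times
         (Plus (Parity i)
           (Times (Dist j (Plus i two))
             (Times (Plus (Dist j (Plus i one)) (Comp (Oracle 1) [Proj 0]))
               (Plus (Dist j (Minus i one)) (Comp (Oracle 1) [Proj 1])))))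
         (Plus (Is_zero (Parity i)) (Dist j (Minus i two)))))"

text \<open>A sum of naturals is 0 iff both terms are, a product iff some factor is. The
  \<open>if\<close> of \<open>step\<close> becomes a disjunction of two branches guarded by the
  parity of the rank.\<close>

lemma evaluates_step_prog:
  assumes \<pi>: "decides \<pi> E" and os: "os = [binary \<pi>, unary (truth_value (rho E))]"
  shows "\<exists>v. evaluates os step_prog [y, x] v \<and> (v = 0 \<longleftrightarrow> step E x y)"
proof -
  let ?i = "index E x" and ?j = "index E y" and ?r = "truth_value (rho E)"
  let ?v = "of_bool (\<pi> x y = 0) +
    (?i mod 2 + ((?j - (?i + Suc (Suc 0))) + (?i + Suc (Suc 0) - ?j)) *
        ((((?j - (?i + Suc 0)) + (?i + Suc 0 - ?j)) + ?r y) *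
          (((?j - (?i - Suc 0)) + (?i - Suc 0 - ?j)) + ?r x))) *
      (of_bool (?i mod 2 = 0) + ((?j - (?i - Suc (Suc 0))) + (?i - Suc (Suc 0) - ?j)))"
  have "evaluates os step_prog [y, x] ?v"
    unfolding step_prog_def Let_def
    by (intro evaluates_Plus evaluates_Times evaluates_Minus evaluates_Dist evaluates_Parity
        evaluates_Is_zero evaluates_Succ evaluates.zero evaluates_Index[OF \<pi> os]
        evaluates_Comp2[where a = x and b = y] evaluates_Oracle_binary
        evaluates_Comp1[where p = "Oracle 1" and a = x]
        evaluates_Comp1[where p = "Oracle 1" and a = y]
        evaluates_Oracle_unary evaluates_Proj)
      (auto simp: os)
  moreover have "?v = 0 \<longleftrightarrow> step E x y"
  proof -
    have dist: "(a - b) + (b - a) = 0 \<longleftrightarrow> a = b" for a b :: nat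
      by auto
    have "\<pi> x y = of_bool ((x, y) \<in> E)"
      using \<pi> by (simp add: decides_def)
    then show ?thesis
      \<comment> \<open>Splitting sums also splits the distances, so \<open>dist\<close> is used in
        its split form.\<close>
      unfolding add_eq_0_iff_both_eq_0 mult_eq_0_iff dist[unfolded add_eq_0_iff_both_eq_0]
      by (auto simp: step_def truth_value_def even_iff_mod_2_eq_zero)
  qed
  ultimately show ?thesis
    by (intro exI conjI)
qed

text \<open>The search over \<open>y\<close> halts because every \<open>x\<close> has a successor
  under \<open>step\<close>.\<close>

lemma computes_from_perm:
  assumes E: "equiv UNIV E" and \<pi>: "decides \<pi> E"
  shows "computes_from (Mu step_prog) [binary \<pi>, unary (truth_value (rho E))] (unary (perm E))"
  unfolding computes_from_unary
proof
  fix x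
  let ?os = "[binary \<pi>, unary (truth_value (rho E))]"
  have "\<forall>y. \<exists>v. evaluates ?os step_prog [y, x] v \<and> (v = 0 \<longleftrightarrow> step E x y)"
    using evaluates_step_prog[OF \<pi> refl] by blast
  \<comment> \<open>\<open>evaluates_Mu\<close> needs the values of the searched program as a
    function of \<open>y\<close>.\<close>
  from choice[OF this] obtain v where v: "\<And>y. evaluates ?os step_prog [y, x] (v y)"
      "\<And>y. v y = 0 \<longleftrightarrow> step E x y"
    by blast
  obtain y where "v y = 0"
    using step_total[OF E, of x] v(2) by blast
  then have "evaluates ?os (Mu step_prog) [x] (LEAST y. v y = 0)"
    by (rule evaluates_Mu[where g = v, OF v(1)])
  then show "evaluates ?os (Mu step_prog) [x] (perm E x)"
    by (simp add: perm_def[OF E] v(2))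
qed

section \<open>Permutability, recursiveness of \<open>rho\<close>, and the uniform programs\<close>

theorem theorem3p17:
  shows "(\<forall>E \<pi>. equiv_decided_by E \<pi> \<longrightarrow>
            (permutable E \<longleftrightarrow> recursive (unary (truth_value (rho E)))))
    \<and> (\<exists>p. \<forall>E \<pi> g. equiv_decided_by E \<pi> \<and> recursive_perm_for E g \<and> normal g \<longrightarrow>
            computes_from p [unary g] (unary (truth_value (rho E))))
    \<and> (\<exists>p. \<forall>E \<pi> f. equiv_decided_by E \<pi> \<and> recursive_perm_for E f \<longrightarrow>
            computes_from p [binary \<pi>, unary f] (unary (truth_value (rho E))))
    \<and> (\<exists>p. \<forall>E \<pi>. equiv_decided_by E \<pi> \<and> recursive (unary (truth_value (rho E))) \<longrightarrow>
            (\<exists>f. recursive_perm_for E f \<and>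
              computes_from p [binary \<pi>, unary (truth_value (rho E))] (unary f)))"
proof (intro conjI)
  have to_perm: "recursive_perm_for E (perm E) \<and>
      computes_from (Mu step_prog) [binary \<pi>, unary (truth_value (rho E))] (unary (perm E))"
    if "equiv_decided_by E \<pi>" "recursive (unary (truth_value (rho E)))" for E \<pi>
  proof -
    have E: "equiv UNIV E" "recursive (binary \<pi>)" "decides \<pi> E"
      using that(1) by (auto simp: equiv_decided_by_def)
    note computes = computes_from_perm[OF E(1,3)]
    moreover have "recursive (unary (perm E))"
      using recursive_if_computes_from[OF computes] E(2) that(2) by simp
    ultimately show ?thesis
      using bij_perm[OF E(1)] cycles_perm[OF E(1)] by (simp add: recursive_perm_for_def)
  qed
  \<comment> \<open>The oracle list stays general, since the permutation is oracle 0 in one claim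
    and oracle 1 in another.\<close>
  have to_rho: "computes_from (rho_prog (Oracle i)) os (unary (truth_value (rho E)))"
    if "equiv_decided_by E \<pi>" "recursive_perm_for E f" "i < length os" "os ! i = unary f"
    for E \<pi> f os i
    using that
    by (intro computes_from_rho_prog[where f = f] evaluates_Oracle_unary) (auto simp: equiv_decided_by_def)
  show "\<forall>E \<pi>. equiv_decided_by E \<pi> \<longrightarrow>
      (permutable E \<longleftrightarrow> recursive (unary (truth_value (rho E))))"
  proof (intro allI impI iffI)
    fix E \<pi>
    assume E: "equiv_decided_by E \<pi>"
    show "permutable E" if "recursive (unary (truth_value (rho E)))"
      using to_perm[OF E that] by (auto simp: permutable_def)
    assume "permutable E"
    then obtain f where f: "recursive_perm_for E f"
      by (auto simp: permutable_def)
    then have "list_all recursive [unary f]"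
      by (simp add: recursive_perm_for_def)
    then show "recursive (unary (truth_value (rho E)))"
      using to_rho[OF E f, of 0 "[unary f]"] recursive_if_computes_from by simp
  qed
  show "\<exists>p. \<forall>E \<pi> g. equiv_decided_by E \<pi> \<and> recursive_perm_for E g \<and> normal g \<longrightarrow>
      computes_from p [unary g] (unary (truth_value (rho E)))"
    by (rule exI[of _ "rho_prog (Oracle 0)"]) (auto intro: to_rho)
  show "\<exists>p. \<forall>E \<pi> f. equiv_decided_by E \<pi> \<and> recursive_perm_for E f \<longrightarrow>
      computes_from p [binary \<pi>, unary f] (unary (truth_value (rho E)))"
    by (rule exI[of _ "rho_prog (Oracle 1)"]) (auto intro: to_rho)
  show "\<exists>p. \<forall>E \<pi>. equiv_decided_by E \<pi> \<and> recursive (unary (truth_value (rho E))) \<longrightarrow>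
      (\<exists>f. recursive_perm_for E f \<and>
        computes_from p [binary \<pi>, unary (truth_value (rho E))] (unary f))"
    using to_perm by blast
qed

end
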